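(* For every positive integer $n\le 100$, $$\gamma_{\{2\}}(G_{4,n})=\begin{cases} 2n+2, & n=1;\\ 2n+1, & n\in\{2,3,5,6\};\\ 2n, & n\in\{4\}\cup\{7,\dots,14\}\cup\{16,17\};\\ 2n-1, & n\in\{15\}\cup\{18,\dots,25\}\cup\{27,28\};\\ 2n-2, & n\in\{26\}\cup\{29,\dots,36\}\cup\{38\};\\ 2n-3, & n\in\{37\}\cup\{39,\dots,47\};\\ 2n-4, & n\in\{48,\dots,58\};\\ 2n-5, & n\in\{59,\dots,68\};\\ 2n-6, & n\in\{69,\dots,78\};\\ 2n-7, & n\in\{79,\dots,88\};\\ 2n-8, & n\in\{89,\dots,98\};\\ 2n-9, & n\in\{99,100\}. \end{cases}$$
   Context: For positive integers $m,n$, the grid graph $G_{m,n}=P_m\square P_n$ has vertex set $\{v_{i,j}: 1\le i\le m,\ 1\le j\le n\}$, where $v_{i_1,j_1}v_{i_2,j_2}$ is an edge iff ($|i_1-i_2|=1$ and $j_1=j_2$) or ($i_1=i_2$ and $|j_1-j_2|=1$). For a graph $G=(V,E)$ and $v\in V$, $N[v]$ denotes the closed neighborhood of $v$. An integer $\{2\}$-dominating function of $G$ is a function $f:V\to\mathbb{Z}_{\ge 0}$ with $\sum_{y\in N[x]} f(y)\ge 2$ for every $x\in V$; the integer $\{2\}$-domination number $\gamma_{\{2\}}(G)$ is the minimum of $\sum_{x\in V} f(x)$ over all integer $\{2\}$-dominating functions $f$ of $G$. *)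

theory Defs
  imports Main
begin

text \<open>A graph is given by a vertex set \<open>V\<close> and an adjacency relation \<open>E\<close> on it.\<close>

definition closed_nbhd :: "'a set \<Rightarrow> ('a \<Rightarrow> 'a \<Rightarrow> bool) \<Rightarrow> 'a \<Rightarrow> 'a set" where
  "closed_nbhd V E x = {y \<in> V. y = x \<or> E x y}"

text \<open>Functions are total on the ambient type; their values outside \<open>V\<close> are unconstrained and
  enter neither the domination condition nor the weight.\<close>

definition two_dominating :: "'a set \<Rightarrow> ('a \<Rightarrow> 'a \<Rightarrow> bool) \<Rightarrow> ('a \<Rightarrow> nat) \<Rightarrow> bool" where
  "two_dominating V E f \<longleftrightarrow> (\<forall>x\<in>V. (\<Sum>y\<in>closed_nbhd V E x. f y) \<ge> 2)"

definition two_domination_number :: "'a set \<Rightarrow> ('a \<Rightarrow> 'a \<Rightarrow> bool) \<Rightarrow> nat" where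
  "two_domination_number V E = (LEAST k. \<exists>f. two_dominating V E f \<and> k = (\<Sum>x\<in>V. f x))"

text \<open>On a finite graph the minimum exists, since the constant function 2 is dominating.\<close>

lemma two_domination_number_attained:
  assumes "finite V"
  shows "\<exists>f. two_dominating V E f \<and> two_domination_number V E = (\<Sum>x\<in>V. f x)"
proof -
  have "two_dominating V E (\<lambda>_. 2)"
    unfolding two_dominating_def
  proof
    fix x assume "x \<in> V"
    then have "x \<in> closed_nbhd V E x" and "finite (closed_nbhd V E x)"
      using assms by (auto simp: closed_nbhd_def)
    then show "(\<Sum>y\<in>closed_nbhd V E x. 2) \<ge> (2::nat)"
      using member_le_sum[of x "closed_nbhd V E x" "\<lambda>_. 2::nat"] by simp
  qed
  then have "\<exists>k f. two_dominating V E f \<and> k = (\<Sum>x\<in>V. f x)" by blast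
  then show ?thesis
    unfolding two_domination_number_def by (rule LeastI_ex)
qed

definition grid_verts :: "nat \<Rightarrow> nat \<Rightarrow> (nat \<times> nat) set" where
  "grid_verts m n = {1..m} \<times> {1..n}"

definition grid_adj :: "nat \<Rightarrow> nat \<Rightarrow> nat \<times> nat \<Rightarrow> nat \<times> nat \<Rightarrow> bool" where
  "grid_adj m n u v \<longleftrightarrow> u \<in> grid_verts m n \<and> v \<in> grid_verts m n \<and>
     (\<bar>int (fst u) - int (fst v)\<bar> = 1 \<and> snd u = snd v \<or>
      fst u = fst v \<and> \<bar>int (snd u) - int (snd v)\<bar> = 1)"

end

theory Submission
  imports Defs
begin

text \<open>
  Scan the grid column by column; the state after \<open>k\<close> columns is the last column together with the
  weight that each of its cells still lacks. The lower bound assigns to every state a function of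
  \<open>k\<close> that majorizes the gain \<open>2 k - weight\<close> of the columns read so far. In the long run one unit is
  gained per ten columns, so these functions have the shape \<open>(k + a) div 10\<close>, raised by one on a
  finite set of exceptional \<open>k\<close>; that they are preserved by every transition is a finite check,
  uniform in \<open>k\<close>. The upper bound inserts copies of a cycle of ten columns and weight 19 into finitely
  many optimal patterns.
\<close>

section \<open>Columns, requirements and potentials\<close>

type_synonym column = "nat \<times> nat \<times> nat \<times> nat"

fun weight :: "column \<Rightarrow> nat" where
  "weight (a, b, c, d) = a + b + c + d"

fun col_le :: "column \<Rightarrow> column \<Rightarrow> bool" where
  "col_le (a, b, c, d) (a', b', c', d') \<longleftrightarrow> a \<le> a' \<and> b \<le> b' \<and> c \<le> c' \<and> d \<le> d'"

fun flip :: "column \<Rightarrow> column" where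
  "flip (a, b, c, d) = (d, c, b, a)"

text \<open>\<open>need a b\<close> is what column \<open>b\<close>, preceded by \<open>a\<close>, requires of the next column; the subtraction is
  truncated.\<close>

fun need :: "column \<Rightarrow> column \<Rightarrow> column" where
  "need (a1, a2, a3, a4) (b1, b2, b3, b4) =
    (2 - a1 - b1 - b2, 2 - a2 - b1 - b2 - b3, 2 - a3 - b2 - b3 - b4, 2 - a4 - b3 - b4)"

type_synonym potential = "int \<times> int list"

fun pot :: "potential \<Rightarrow> int \<Rightarrow> int" where
  "pot (a, E) k = (k + a) div 10 + of_bool (k \<in> set E)"

text \<open>A finite test that compares two potentials at all \<open>k\<close> at once. Off
  \<open>E\<close> monotonicity of the floor is enough; on \<open>E\<close> the extra unit must be
  absorbed by a jump of the floor or by an exception in \<open>E'\<close>.\<close>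

fun pot_le :: "potential \<Rightarrow> potential \<Rightarrow> bool" where
  "pot_le (a, E) (a', E') \<longleftrightarrow> a \<le> a' \<and>
    (a + 10 \<le> a' \<or> list_all (\<lambda>k. (k + a) div 10 + 1 \<le> (k + a') div 10 \<or> k \<in> set E') E)"

text \<open>A column of weight \<open>x\<close> changes the gain by \<open>2 - x\<close>, which shifts \<open>a\<close> by \<open>20 - 10 x\<close>; passing from
  \<open>k\<close> to \<open>k + 1\<close> shifts both components of the target potential.\<close>

fun step_le :: "nat \<Rightarrow> potential \<Rightarrow> potential \<Rightarrow> bool" where
  "step_le x (a, E) (a', E') \<longleftrightarrow> pot_le (a + 20 - 10 * int x, E) (a' + 1, map (\<lambda>k. k - 1) E')"

abbreviation pick :: "nat \<Rightarrow> 'a \<Rightarrow> 'a \<Rightarrow> 'a \<Rightarrow> 'a" where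
  "pick i x y z \<equiv> (case i of 0 \<Rightarrow> x | Suc j \<Rightarrow> (case j of 0 \<Rightarrow> y | Suc _ \<Rightarrow> z))"

text \<open>
  An entry \<open>(m, p)\<close> of \<open>table b\<close> covers all states with last column \<open>b\<close> that lack at least \<open>m\<close>. Of a state
  and its mirror image only one is listed. The offset \<open>a\<close> comes from the largest gain that a state may
  have for large \<open>k\<close> without allowing a total weight below the claimed minimum; the exceptional sets are
  then the least ones closed under transitions.
\<close>

fun table :: "column \<Rightarrow> (column \<times> potential) list" where
  "table (a, b, c, d) = (
    pick a
     (pick b
      (pick c
       (pick d
         [((0,0,0,0), -9, [0]), ((0,0,0,1), 0, []), ((0,0,1,0), -5, []), ((0,0,0,2), 6, []),
          ((0,0,1,1), 1, []), ((1,0,0,1), 3, []), ((0,0,1,2), 7, []), ((0,0,2,1), 5, []),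
          ((0,1,2,0), -1, [7,10,18,29,40]), ((0,2,0,1), 4, []), ((0,0,2,2), 13, []),
          ((0,1,1,2), 11, []), ((0,2,0,2), 12, []), ((0,2,1,1), 9, []), ((0,2,2,0), 9, []),
          ((1,0,2,1), 10, []), ((1,1,0,2), 7, []), ((1,1,1,1), 9, []), ((2,0,0,2), 7, []),
          ((0,1,2,2), 19, []), ((1,1,2,1), 15, []), ((2,0,1,2), 11, [5,8,16,27,38])]
         [((0,0,0,0), -9, []), ((0,0,0,1), -3, [2]), ((0,0,1,0), -5, []), ((0,1,0,0), -5, []),
          ((1,0,0,0), -3, []), ((0,0,1,1), 1, []), ((0,1,0,1), -1, []), ((1,0,1,0), -2, []),
          ((2,0,0,0), -3, [9,12,20,31,42]), ((0,2,0,1), 2, [6]),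
          ((0,2,1,0), -1, [7,10,18,29,40]), ((1,0,1,1), 3, []), ((1,1,1,0), 1, []),
          ((1,2,0,0), 5, []), ((2,0,1,0), 2, []), ((2,1,0,0), 3, [5,16]), ((1,1,1,1), 9, []),
          ((1,2,0,1), 9, []), ((2,0,1,1), 7, []), ((2,1,1,0), 11, [])]
         [((0,0,0,0), -9, []), ((0,1,0,0), -8, []), ((1,0,0,0), -7, [5]),
          ((0,2,0,0), -8, [3,6,7]), ((1,1,0,0), -5, []), ((2,0,0,0), -7, [2,6]),
          ((1,2,0,0), 2, []), ((2,1,0,0), 3, []), ((2,2,0,0), 12, [])])
       (pick d
         [((0,0,0,0), -9, []), ((0,0,0,1), 0, []), ((0,0,1,0), -5, []), ((0,1,0,0), -5, []),
          ((1,0,0,0), -3, []), ((0,0,1,1), 1, []), ((0,1,1,0), -5, [4,11,14,22,33,44]),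
          ((2,0,0,0), 1, [8]), ((1,0,1,1), 3, []), ((1,1,0,1), 3, []), ((1,1,1,0), 1, []),
          ((2,0,0,1), 1, [5,8,16,27,38]), ((2,0,1,0), 4, []), ((1,1,1,1), 9, []),
          ((2,1,0,1), 7, []), ((2,1,1,0), 11, [])]
         [((0,0,0,0), -9, [7,18]), ((0,1,0,0), -6, []), ((1,0,0,0), -4, []), ((1,1,0,0), -3, []),
          ((2,1,0,0), 3, [])]
         [((0,0,0,0), -9, []), ((0,1,0,0), -8, []), ((1,0,0,0), -8, []), ((1,1,0,0), -8, [6,17]),
          ((2,0,0,0), -7, []), ((2,1,0,0), 2, [])])
       (pick d
         [((0,0,0,0), -9, [4,7,8]), ((1,0,0,0), -6, []), ((2,0,0,0), -6, [1,5])]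
         [((0,0,0,0), -9, []), ((1,0,0,0), -6, []), ((2,0,0,0), -6, [])]
         [((0,0,0,0), -9, []), ((2,0,0,0), -8, [])]))
      (pick c
       (pick d
         []
         [((0,0,0,0), -9, []), ((0,0,0,1), -4, []), ((0,1,0,0), -6, []), ((1,0,0,0), -4, []),
          ((0,1,0,1), -3, []), ((1,1,0,0), -2, []), ((1,1,0,1), -1, [])]
         [((0,0,0,0), -9, []), ((0,1,0,0), -9, []), ((1,0,0,0), -7, []), ((1,1,0,0), -5, [])])
       (pick d
         [((0,0,0,0), -9, [4,7,8,15,18,26,37,48]), ((0,0,0,1), -6, []),
          ((1,0,0,1), -6, [1,5,12,15,23,34,45])]
         [((0,0,0,0), -10, []), ((1,0,0,0), -10, [])]
         [((0,0,0,0), -10, []), ((1,0,0,0), -10, [])])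
       (pick d
         [((0,0,0,0), -12, [8,11,19,30,41]), ((1,0,0,0), -12, [1])]
         [((0,0,0,0), -12, [])]
         [((0,0,0,0), -12, []), ((1,0,0,0), -12, [])]))
      (pick c
       (pick d [] [((0,0,0,0), -9, [7]), ((0,0,0,1), -7, [])] [((0,0,0,0), -9, [])])
       (pick d [] [((0,0,0,0), -12, [])] [((0,0,0,0), -13, [])])
       (pick d [((0,0,0,0), -12, [])] [((0,0,0,0), -13, [])] [((0,0,0,0), -13, [])])))
     (pick b
      (pick c
       (pick d
         []
         [((0,0,0,0), -9, []), ((0,0,0,1), -7, []), ((0,0,1,1), -2, []), ((0,1,0,1), -5, []),
          ((0,1,1,0), -8, [3,6,7,14,17,25,36,47]), ((1,0,0,1), -7, [2,5,6,13,16,24,35,46]),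
          ((1,0,1,1), -1, []), ((1,1,1,1), 9, [])]
         [((0,0,0,0), -14, [3,10,13,21,32,43]), ((1,0,0,0), -10, [6,9,17,28,39]),
          ((1,1,0,0), -5, [])])
       (pick d
         []
         [((0,0,0,0), -12, []), ((1,0,0,0), -8, [])]
         [((0,0,0,0), -14, []), ((1,0,0,0), -14, [])])
       (pick d [] [((0,0,0,0), -12, []), ((1,0,0,0), -11, [])] [((0,0,0,0), -14, [])]))
      (pick c
       (pick d [] [] [((0,0,0,0), -14, [])])
       (pick d [] [((0,0,0,0), -12, [])] [((0,0,0,0), -18, [])])
       (pick d [] [((0,0,0,0), -16, [])] [((0,0,0,0), -18, [])]))
      (pick c
       (pick d [] [] [((0,0,0,0), -15, [])])
       (pick d [] [] [((0,0,0,0), -19, [])])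
       (pick d [] [((0,0,0,0), -16, [])] [((0,0,0,0), -19, [])])))
     (pick b
      (pick c
       (pick d [] [] [((0,0,0,0), -14, [])])
       (pick d [] [] [((0,0,0,0), -20, [6,9,17,28,39])])
       (pick d [] [] [((0,0,0,0), -24, [])]))
      (pick c
       (pick d [] [] [])
       (pick d [] [] [((0,0,0,0), -24, [])])
       (pick d [] [] [((0,0,0,0), -24, [])]))
      (pick c
       (pick d [] [] [])
       (pick d [] [] [])
       (pick d [] [] [((0,0,0,0), -28, [])]))))"

declare table.simps [simp del]

definition states :: "column \<Rightarrow> (column \<times> potential) list" where
  "states c = table c @ map (\<lambda>(m, p). (flip m, p)) (table (flip c))"

text \<open>Entries stop at 2 because a dominating function may be capped there, see
  \<open>two_dominating_cap\<close>.\<close>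

fun columns_above :: "column \<Rightarrow> column list" where
  "columns_above (a, b, c, d) =
    [(a', b', c', d'). a' \<leftarrow> [a..<3], b' \<leftarrow> [b..<3], c' \<leftarrow> [c..<3], d' \<leftarrow> [d..<3]]"

declare columns_above.simps [simp del]

text \<open>The claimed gain. The exception \<open>0\<close> accommodates the empty grid.\<close>

definition target :: potential where
  "target = (- 9, [0, 4, 7, 8, 15, 18, 26, 37, 48])"

definition transition_ok :: "column \<Rightarrow> potential \<Rightarrow> column \<Rightarrow> bool" where
  "transition_ok b p c \<longleftrightarrow>
    list_ex (\<lambda>(m', p'). col_le m' (need b c) \<and> step_le (weight c) p p') (states c)"

text \<open>A state lacking at least \<open>m\<close> continues only with columns above
  \<open>m\<close>, so these exhaust its successors. The scan may stop only where nothing is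
  lacking, hence \<open>target\<close> is compared only with entries whose \<open>m\<close> is
  zero.\<close>

definition closed_at :: "column \<Rightarrow> bool" where
  "closed_at b \<longleftrightarrow>
    list_all (\<lambda>(m, p). (m = (0, 0, 0, 0) \<longrightarrow> pot_le p target) \<and>
      list_all (transition_ok b p) (columns_above m)) (table b)"

section \<open>Soundness of the finite check\<close>

lemma pot_target:
  assumes "n \<noteq> 0"
  shows "pot target (int n) = (int n - 9) div 10 + of_bool (n \<in> {4, 7, 8, 15, 18, 26, 37, 48})"
proof -
  have "pot p k = (k + fst p) div 10 + of_bool (k \<in> set (snd p))" for p k
    by (cases p) simp
  moreover have "int n \<in> set (snd target) \<longleftrightarrow> n \<in> {4, 7, 8, 15, 18, 26, 37, 48}"
    using assms by (simp add: target_def)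
  moreover have "int n + fst target = int n - 9"
    by (simp add: target_def)
  ultimately show ?thesis by (simp only:)
qed

lemma pot_le_sound:
  assumes "pot_le p q"
  shows "pot p k \<le> pot q k"
proof -
  obtain a E a' E' where pq: "p = (a, E)" "q = (a', E')"
    by (cases p, cases q) auto
  have mono: "(k + a) div 10 \<le> (k + a') div 10"
    using assms pq by (auto intro: zdiv_mono1)
  show ?thesis
  proof (cases "a + 10 \<le> a'")
    case True
    then have "(k + a + 10) div 10 \<le> (k + a') div 10"
      by (intro zdiv_mono1) simp_all
    then have "(k + a) div 10 + 1 \<le> (k + a') div 10"
      by simp
    then show ?thesis by (simp add: pq)
  next
    case False
    then show ?thesis
      using assms mono by (auto simp: pq list_all_iff)
  qed
qed

lemma step_le_sound:
  assumes "step_le x p q"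
  shows "pot p k + 2 - int x \<le> pot q (k + 1)"
proof -
  obtain a E a' E' where pq: "p = (a, E)" "q = (a', E')"
    by (cases p, cases q) auto
  have "(k + (a + 20 - 10 * int x)) div 10 = (k + a) div 10 + 2 - int x"
    using div_mult_self1[of 10 "k + a" "2 - int x"] by (simp add: algebra_simps)
  moreover have "k \<in> (\<lambda>k. k - 1) ` set E' \<longleftrightarrow> k + 1 \<in> set E'"
    by force
  ultimately show ?thesis
    using pot_le_sound[of "(a + 20 - 10 * int x, E)" "(a' + 1, map (\<lambda>k. k - 1) E')" k] assms
    by (simp add: pq algebra_simps)
qed

lemma col_le_trans: "col_le a b \<Longrightarrow> col_le b c \<Longrightarrow> col_le a c"
  by (cases a; cases b; cases c) auto

lemma flip_flip [simp]: "flip (flip c) = c"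
  by (cases c) simp

lemma col_le_flip [simp]: "col_le (flip a) (flip b) \<longleftrightarrow> col_le a b"
  by (cases a; cases b) auto

lemma weight_flip [simp]: "weight (flip c) = weight c"
  by (cases c) simp

text \<open>Reversing the four rows is a symmetry of the grid; this is why \<open>table\<close> can
  omit mirror images.\<close>

lemma need_flip: "need (flip a) (flip b) = flip (need a b)"
  by (cases a; cases b) (simp add: ac_simps)

lemma flip_zero_iff: "(0, 0, 0, 0) = flip m \<longleftrightarrow> m = (0, 0, 0, 0)"
  by (cases m) auto

lemma states_flip: "(m, p) \<in> set (states (flip c)) \<longleftrightarrow> (flip m, p) \<in> set (states c)"
proof -
  have "(m, p) \<in> set (map (\<lambda>(m, p). (flip m, p)) xs) \<longleftrightarrow> (flip m, p) \<in> set xs" for m xs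
    by (auto intro: image_eqI[of _ _ "(flip m, p)"])
  then show ?thesis
    unfolding states_def by auto
qed

lemma set_columns_above:
  "c \<in> set (columns_above m) \<longleftrightarrow> col_le m c \<and> col_le c (2, 2, 2, 2)"
proof -
  have "x < 3 \<longleftrightarrow> x \<le> 2" for x :: nat by auto
  then show ?thesis
    by (cases m; cases c) (auto simp: columns_above.simps image_iff)
qed

text \<open>The computation behind the lower bound. It visits the 81 columns with entries at most 2
  and never a particular length, since potentials are compared for all \<open>k\<close>
  together.\<close>

lemma closed_everywhere: "list_all closed_at (columns_above (0, 0, 0, 0))"
  by code_simp

lemma closed_at:
  assumes "col_le b (2, 2, 2, 2)"
  shows "closed_at b"
proof -
  have "col_le (0, 0, 0, 0) b" by (cases b) simp
  then show ?thesis
    using closed_everywhere assms by (simp add: list_all_iff set_columns_above)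
qed

lemma transition:
  assumes "(m, p) \<in> set (states b)" "col_le b (2, 2, 2, 2)"
    and "col_le m c" "col_le c (2, 2, 2, 2)"
  shows "\<exists>(m', p') \<in> set (states c). col_le m' (need b c) \<and> step_le (weight c) p p'"
proof -
  have in_table: "\<exists>(m', p') \<in> set (states c). col_le m' (need b c) \<and> step_le (weight c) p p'"
    if "(m, p) \<in> set (table b)" "col_le b (2, 2, 2, 2)" "col_le m c" "col_le c (2, 2, 2, 2)"
    for m b c
    using closed_at[OF that(2)] that
    by (fastforce simp: closed_at_def transition_ok_def list_all_iff list_ex_iff set_columns_above)
  consider "(m, p) \<in> set (table b)" | "(flip m, p) \<in> set (table (flip b))"
    using assms(1) by (auto simp: states_def)
  then show ?thesis
  proof cases
    case 1
    then show ?thesis using in_table assms by blast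
  next
    \<comment> \<open>A mirrored entry is treated by reflecting the whole step, applying the check
      to \<open>flip b\<close> and \<open>flip c\<close>, and reflecting the result back.\<close>
    case 2
    have top: "col_le (flip x) (2, 2, 2, 2) \<longleftrightarrow> col_le x (2, 2, 2, 2)" for x
      by (cases x) auto
    obtain m' p' where "(m', p') \<in> set (states (flip c))"
      "col_le m' (need (flip b) (flip c))" "step_le (weight (flip c)) p p'"
      using in_table[OF 2, of "flip c"] assms by (auto simp: top)
    then have "(flip m', p') \<in> set (states c)" "col_le (flip m') (need b c)"
      "step_le (weight c) p p'"
      using col_le_flip[of "flip m'" "need b c"] by (auto simp: states_flip need_flip)
    then show ?thesis by blast
  qed
qed

lemma final_potential:
  assumes "((0, 0, 0, 0), p) \<in> set (states b)" "col_le b (2, 2, 2, 2)"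
  shows "pot p k \<le> pot target k"
proof -
  have in_table: "pot_le p target"
    if "((0, 0, 0, 0), p) \<in> set (table b)" "col_le b (2, 2, 2, 2)" for b
    using bspec[OF closed_at[OF that(2), unfolded closed_at_def list_all_iff] that(1)] by simp
  have "col_le (flip b) (2, 2, 2, 2)"
    using assms(2) by (cases b) auto
  moreover have "((0, 0, 0, 0), p) \<in> set (table b) \<or> ((0, 0, 0, 0), p) \<in> set (table (flip b))"
    using assms(1) by (auto simp: states_def flip_zero_iff)
  ultimately have "pot_le p target"
    using in_table assms(2) by blast
  then show ?thesis by (rule pot_le_sound)
qed

section \<open>Lower bound for sequences of columns\<close>

lemma weight_sum_ge:
  fixes C :: "nat \<Rightarrow> column"
  assumes dom: "\<And>j. 1 \<le> j \<Longrightarrow> j \<le> n \<Longrightarrow> col_le (need (C (j - 1)) (C j)) (C (j + 1))"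
    and ends: "C 0 = (0, 0, 0, 0)" "C (n + 1) = (0, 0, 0, 0)"
    and le2: "\<And>j. col_le (C j) (2, 2, 2, 2)"
  shows "2 * int n - pot target (int n) \<le> (\<Sum>j=1..n. int (weight (C j)))"
proof -
  \<comment> \<open>The requirement on column \<open>k + 1\<close>. Nothing is asked of the first
    column, as the padding column 0 need not be dominated.\<close>
  define N where "N k = (if k = 0 then (0, 0, 0, 0) else need (C (k - 1)) (C k))" for k
  have next_le: "col_le (N k) (C (k + 1))" if "k \<le> n" for k
  proof (cases "k = 0")
    case True
    then show ?thesis by (cases "C 1") (simp add: N_def)
  next
    case False
    then show ?thesis using dom[of k] that by (simp add: N_def)
  qed
  have inv: "\<exists>(m, p) \<in> set (states (C k)). col_le m (N k) \<and>
      2 * int k - (\<Sum>j=1..k. int (weight (C j))) \<le> pot p (int k)" if "k \<le> n" for k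
    using that
  proof (induction k)
    case 0
    \<comment> \<open>The gain is 0 at the start but the floor of -9/10 is -1; the exception 0
      supplies the missing unit.\<close>
    have "((0, 0, 0, 0), - 9, [0]) \<in> set (states (C 0))"
      by (simp add: ends states_def table.simps)
    then show ?case by (force simp: N_def)
  next
    case (Suc k)
    then obtain m p where mp: "(m, p) \<in> set (states (C k))" "col_le m (N k)"
      "2 * int k - (\<Sum>j=1..k. int (weight (C j))) \<le> pot p (int k)"
      by fastforce
    have "col_le m (C (Suc k))"
      using mp(2) next_le[of k] Suc.prems by (auto intro: col_le_trans)
    from transition[OF mp(1) le2 this le2] obtain m' p' where
      *: "(m', p') \<in> set (states (C (Suc k)))" "col_le m' (N (Suc k))"
        "step_le (weight (C (Suc k))) p p'"
      by (auto simp: N_def)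
    have "2 * int (Suc k) - (\<Sum>j=1..Suc k. int (weight (C j))) \<le> pot p' (int (Suc k))"
      using step_le_sound[OF *(3), of "int k"] mp(3) by (simp add: add.commute)
    then show ?case using * by blast
  qed
  obtain m p where mp: "(m, p) \<in> set (states (C n))" "col_le m (N n)"
    "2 * int n - (\<Sum>j=1..n. int (weight (C j))) \<le> pot p (int n)"
    using inv[of n] by auto
  \<comment> \<open>The zero column after the last one satisfies the remaining requirement, so that
    requirement is zero.\<close>
  have "col_le m (0, 0, 0, 0)"
    using mp(2) next_le[of n] ends by (auto intro: col_le_trans)
  then have "m = (0, 0, 0, 0)" by (cases m) simp
  then show ?thesis
    using final_potential[of p "C n" "int n"] mp le2[of n] by simp
qed

section \<open>From functions on the grid to columns\<close>

text \<open>Zero columns on both sides play the role of absent neighbours, so border columns obey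
  the same rule as inner ones.\<close>

definition column_of :: "nat \<Rightarrow> (nat \<times> nat \<Rightarrow> nat) \<Rightarrow> nat \<Rightarrow> column" where
  "column_of n f j = (if 1 \<le> j \<and> j \<le> n then (f (1, j), f (2, j), f (3, j), f (4, j)) else (0, 0, 0, 0))"

text \<open>After extension by zero, every closed neighbourhood may be replaced by the full cross of
  five cells.\<close>

lemma grid_nbhd_sum:
  fixes f :: "nat \<times> nat \<Rightarrow> nat"
  assumes "(i, j) \<in> grid_verts m n"
  defines "F \<equiv> \<lambda>x. if x \<in> grid_verts m n then f x else 0"
  shows "(\<Sum>y \<in> closed_nbhd (grid_verts m n) (grid_adj m n) (i, j). f y) =
    F (i, j) + F (i - 1, j) + F (i + 1, j) + F (i, j - 1) + F (i, j + 1)"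
proof -
  let ?N = "closed_nbhd (grid_verts m n) (grid_adj m n) (i, j)"
  let ?S = "{(i, j), (i - 1, j), (i + 1, j), (i, j - 1), (i, j + 1)}"
  have ij: "1 \<le> i" "1 \<le> j"
    using assms(1) by (auto simp: grid_verts_def)
  have N: "?N = ?S \<inter> grid_verts m n"
  proof (intro set_eqI, clarify)
    fix a b
    have dist1: "\<bar>int x - int y\<bar> = 1 \<longleftrightarrow> y = x - 1 \<or> y = x + 1" if "1 \<le> x" for x y
      using that by linarith
    have "(a, b) \<in> ?N \<longleftrightarrow> (a, b) \<in> grid_verts m n \<and> (a = i \<and> b = j \<or>
        (a = i - 1 \<or> a = i + 1) \<and> j = b \<or> i = a \<and> (b = j - 1 \<or> b = j + 1))"
      unfolding closed_nbhd_def grid_adj_def mem_Collect_eq fst_conv snd_conv prod.inject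
        dist1[OF ij(1)] dist1[OF ij(2)]
      using assms(1) by blast
    then show "(a, b) \<in> ?N \<longleftrightarrow> (a, b) \<in> ?S \<inter> grid_verts m n"
      by blast
  qed
  have "sum f ?N = sum F ?N"
    by (rule sum.cong) (auto simp: N F_def)
  \<comment> \<open>The five cells are distinct: \<open>i\<close> and \<open>j\<close> are positive,
    so \<open>i - 1\<close> and \<open>j - 1\<close> are not truncated.\<close>
  also have "\<dots> = sum F ?S"
    by (rule sum.mono_neutral_left) (auto simp: N F_def)
  also have "\<dots> = F (i, j) + F (i - 1, j) + F (i + 1, j) + F (i, j - 1) + F (i, j + 1)"
    using ij by (cases i; cases j) (simp_all add: insert_commute)
  finally show ?thesis .
qed

lemma two_dominating_grid4_iff:
  "two_dominating (grid_verts 4 n) (grid_adj 4 n) f \<longleftrightarrow>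
    (\<forall>j \<in> {1..n}. col_le (need (column_of n f (j - 1)) (column_of n f j)) (column_of n f (j + 1)))"
proof -
  define F where "F = (\<lambda>x. if x \<in> grid_verts 4 n then f x else 0)"
  have rows: "{1..4::nat} = {1, 2, 3, 4}" by auto
  have verts: "(\<forall>x \<in> grid_verts 4 n. P x) \<longleftrightarrow> (\<forall>j \<in> {1..n}. \<forall>i \<in> {1, 2, 3, 4}. P (i, j))" for P
    unfolding grid_verts_def rows by blast
  have col: "column_of n f k = (F (1, k), F (2, k), F (3, k), F (4, k))" for k
    by (auto simp: column_of_def F_def grid_verts_def)
  have border: "F (0, k) = 0" "F (5, k) = 0" for k
    by (simp_all add: F_def grid_verts_def)
  have nbhd: "(\<Sum>y \<in> closed_nbhd (grid_verts 4 n) (grid_adj 4 n) (i, j). f y) =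
      F (i, j) + F (i - 1, j) + F (i + 1, j) + F (i, j - 1) + F (i, j + 1)"
    if "i \<in> {1, 2, 3, 4}" "j \<in> {1..n}" for i j
    unfolding F_def by (rule grid_nbhd_sum) (use that in \<open>auto simp: grid_verts_def\<close>)
  have "two_dominating (grid_verts 4 n) (grid_adj 4 n) f \<longleftrightarrow> (\<forall>j \<in> {1..n}. \<forall>i \<in> {1, 2, 3, 4}.
      2 \<le> (\<Sum>y \<in> closed_nbhd (grid_verts 4 n) (grid_adj 4 n) (i, j). f y))"
    unfolding two_dominating_def by (rule verts)
  also have "\<dots> \<longleftrightarrow> (\<forall>j \<in> {1..n}. \<forall>i \<in> {1, 2, 3, 4}.
      2 \<le> F (i, j) + F (i - 1, j) + F (i + 1, j) + F (i, j - 1) + F (i, j + 1))"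
    by (intro ball_cong refl) (simp only: nbhd)
  also have "\<dots> \<longleftrightarrow> (\<forall>j \<in> {1..n}.
      col_le (need (column_of n f (j - 1)) (column_of n f j)) (column_of n f (j + 1)))"
    \<comment> \<open>Truncated subtraction in \<open>need\<close> is undone by
      \<open>le_diff_conv\<close>; rows 0 and 5 contribute nothing.\<close>
    using border by (intro ball_cong refl) (simp add: col le_diff_conv numeral_eq_Suc ac_simps)
  finally show ?thesis .
qed

lemma sum_grid4: "(\<Sum>x \<in> grid_verts 4 n. f x) = (\<Sum>j=1..n. weight (column_of n f j))"
proof -
  have rows: "{1..4::nat} = {1, 2, 3, 4}" by auto
  have "(\<Sum>x \<in> grid_verts 4 n. f x) = (\<Sum>i=1..4. \<Sum>j=1..n. f (i, j))"
    by (simp add: grid_verts_def sum.cartesian_product)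
  also have "\<dots> = (\<Sum>j=1..n. \<Sum>i=1..4. f (i, j))"
    by (rule sum.swap)
  also have "\<dots> = (\<Sum>j=1..n. weight (column_of n f j))"
    unfolding rows by (rule sum.cong) (auto simp: column_of_def)
  finally show ?thesis .
qed

section \<open>Capping at 2 and the lower bound for the grid\<close>

text \<open>A neighbourhood with a value of at least 2 is served by that cell alone even after
  capping; every other neighbourhood keeps its values.\<close>

lemma two_dominating_cap:
  assumes "finite V" "two_dominating V E f"
  shows "two_dominating V E (\<lambda>x. min 2 (f x))"
  unfolding two_dominating_def
proof
  fix x assume "x \<in> V"
  let ?N = "closed_nbhd V E x"
  have fin: "finite ?N" using assms(1) by (simp add: closed_nbhd_def)
  show "2 \<le> (\<Sum>y \<in> ?N. min 2 (f y))"
  proof (cases "\<exists>y \<in> ?N. 2 \<le> f y")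
    case True
    then obtain y where "y \<in> ?N" "2 \<le> f y" by blast
    then show ?thesis
      using member_le_sum[of y ?N "\<lambda>y. min 2 (f y)"] fin by simp
  next
    case False
    then have "(\<Sum>y \<in> ?N. min 2 (f y)) = (\<Sum>y \<in> ?N. f y)"
      by (intro sum.cong) auto
    then show ?thesis
      using assms(2) \<open>x \<in> V\<close> by (simp add: two_dominating_def)
  qed
qed

lemma grid4_lower:
  assumes "two_dominating (grid_verts 4 n) (grid_adj 4 n) f"
  shows "2 * int n - pot target (int n) \<le> int (\<Sum>x \<in> grid_verts 4 n. f x)"
proof -
  define g where "g x = min 2 (f x)" for x
  have "finite (grid_verts 4 n)" by (simp add: grid_verts_def)
  then have "two_dominating (grid_verts 4 n) (grid_adj 4 n) g"
    unfolding g_def using assms by (rule two_dominating_cap)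
  then have "2 * int n - pot target (int n) \<le> (\<Sum>j=1..n. int (weight (column_of n g j)))"
    by (intro weight_sum_ge) (auto simp: two_dominating_grid4_iff column_of_def g_def)
  also have "\<dots> = int (\<Sum>x \<in> grid_verts 4 n. g x)"
    by (simp add: sum_grid4)
  also have "\<dots> \<le> int (\<Sum>x \<in> grid_verts 4 n. f x)"
    by (simp add: g_def sum_mono)
  finally show ?thesis .
qed

section \<open>Words of columns and the upper bound\<close>

type_synonym state = "column \<times> column"

fun run :: "state \<Rightarrow> column list \<Rightarrow> state option" where
  "run s [] = Some s"
| "run (b, m) (c # cs) = (if col_le m c then run (c, need b c) cs else None)"

definition start :: state where
  "start = ((0, 0, 0, 0), (0, 0, 0, 0))"

text \<open>A word may end only where nothing is lacking, because no further column can
  help.\<close>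

definition accepts :: "state \<Rightarrow> column list \<Rightarrow> bool" where
  "accepts s w \<longleftrightarrow> map_option snd (run s w) = Some (0, 0, 0, 0)"

lemma run_append: "run s (u @ v) = Option.bind (run s u) (\<lambda>s. run s v)"
  by (induction s u rule: run.induct) auto

lemma run_pump: "run s v = Some s \<Longrightarrow> run s (concat (replicate k v)) = Some s"
  by (induction k) (auto simp: run_append)

text \<open>The requirement of a letter is tested when \<open>run\<close> reads the next one. For
  the last letter acceptance takes over this test, matching the appended zero column.\<close>

lemma accepts_dominates:
  assumes "accepts (b, m) w" "j < length w"
  defines "X \<equiv> b # w @ [(0, 0, 0, 0)]"
  shows "col_le (need (X ! j) (X ! (j + 1))) (X ! (j + 2))"
  using assms(1,2) unfolding X_def
proof (induction w arbitrary: b m j)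
  case Nil
  then show ?case by simp
next
  case (Cons c cs)
  have acc: "accepts (c, need b c) cs"
    using Cons.prems(1) by (auto simp: accepts_def split: if_splits)
  show ?case
  proof (cases j)
    case 0
    then show ?thesis
    proof (cases cs)
      case Nil
      then show ?thesis using acc 0 by (simp add: accepts_def)
    next
      case (Cons d ds)
      then show ?thesis using acc 0 by (auto simp: accepts_def split: if_splits)
    qed
  next
    case (Suc i)
    then show ?thesis using Cons.IH[OF acc, of i] Cons.prems(2) by simp
  qed
qed

lemma grid4_upper:
  assumes "accepts start w"
  shows "two_domination_number (grid_verts 4 (length w)) (grid_adj 4 (length w)) \<le>
    sum_list (map weight w)"
proof -
  let ?n = "length w"
  \<comment> \<open>The leading zero column makes \<open>X ! j\<close> the column with grid index
    \<open>j\<close>, counted from 1.\<close>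
  define X where "X = (0, 0, 0, 0) # w @ [(0, 0, 0, 0)]"
  define f :: "nat \<times> nat \<Rightarrow> nat" where "f = (\<lambda>(i, j). case X ! j of (a, b, c, d) \<Rightarrow>
    if i = 1 then a else if i = 2 then b else if i = 3 then c else d)"
  have X: "column_of ?n f j = X ! j" if "j \<le> ?n + 1" for j
  proof (cases "1 \<le> j \<and> j \<le> ?n")
    case True
    then show ?thesis by (auto simp: column_of_def f_def split: prod.splits)
  next
    case False
    then have "j = 0 \<or> j = ?n + 1" using that by auto
    then show ?thesis by (auto simp: column_of_def X_def nth_append)
  qed
  have dom: "two_dominating (grid_verts 4 ?n) (grid_adj 4 ?n) f"
    unfolding two_dominating_grid4_iff
  proof
    fix j assume j: "j \<in> {1..?n}"
    then have le: "j - 1 \<le> ?n + 1" "j \<le> ?n + 1" "j + 1 \<le> ?n + 1" by auto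
    have "col_le (need (X ! (j - 1)) (X ! j)) (X ! (j + 1))"
      using accepts_dominates[of "(0, 0, 0, 0)" "(0, 0, 0, 0)" w "j - 1"] assms j
      by (auto simp: start_def X_def)
    then show "col_le (need (column_of ?n f (j - 1)) (column_of ?n f j)) (column_of ?n f (j + 1))"
      by (simp only: X[OF le(1)] X[OF le(2)] X[OF le(3)])
  qed
  have "(\<Sum>x \<in> grid_verts 4 ?n. f x) = (\<Sum>j=1..?n. weight (X ! j))"
    by (simp add: sum_grid4 X)
  also have "\<dots> = (\<Sum>j<?n. weight (w ! j))"
    by (rule sum.reindex_bij_witness[of _ Suc "\<lambda>j. j - 1"]) (auto simp: X_def nth_append)
  also have "\<dots> = sum_list (map weight w)"
    by (simp add: sum_list_sum_nth atLeast0LessThan)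
  finally show ?thesis
    unfolding two_domination_number_def using dom by (intro Least_le) metis
qed

text \<open>Each pair \<open>(u, v)\<close> in \<open>skeletons\<close> is a word \<open>u @ v\<close> that passes through the state \<open>hub\<close> after \<open>u\<close>,
  which is where \<open>cycle\<close> is inserted.\<close>

definition hub :: state where
  "hub = ((1, 1, 0, 1), (0, 0, 0, 0))"

definition cycle :: "column list" where
  "cycle = [
    (0,1,0,0), (0,0,1,1), (2,0,0,0), (0,0,1,1), (0,1,0,0), (1,1,0,1), (0,0,0,1), (1,1,1,0),
    (0,0,0,1), (1,1,0,1)]"

definition skeletons :: "(column list \<times> column list) list" where
  "skeletons = [
    ([(0,1,0,1), (1,1,0,1)], [(0,0,1,0), (1,0,1,0), (1,0,0,1), (0,1,0,1), (0,1,0,0), (1,0,1,1),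
      (1,0,1,0)]),
    ([(0,1,0,1), (1,1,0,1)], [(0,0,1,0), (1,0,1,0), (1,0,0,1), (0,1,0,1), (0,1,0,0), (1,0,1,1),
      (1,0,0,0), (0,1,1,1)]),
    ([(0,1,1,0), (1,0,0,1), (1,1,0,1)], [(0,0,1,0), (1,0,1,0), (1,0,0,1), (0,1,0,1), (0,1,0,0),
      (1,0,1,1), (1,0,0,0), (0,1,1,1)]),
    ([(0,1,0,1), (1,1,0,1)], [(0,0,1,0), (1,0,1,0), (1,0,0,1), (0,1,0,1), (0,1,0,0), (1,0,1,1),
      (1,0,0,0), (0,1,1,1), (1,0,0,0), (1,0,1,1)]),
    ([(0,1,0,1), (1,1,0,1)], [(0,0,0,1), (1,1,1,0), (0,0,0,1), (1,1,0,1), (0,0,1,0), (1,0,1,0),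
      (1,0,0,1), (0,1,0,1), (0,1,0,0), (1,0,1,1), (1,0,1,0)]),
    ([(0,1,0,1), (1,1,0,1)], [(0,0,0,1), (1,1,1,0), (0,0,0,1), (1,1,0,1), (0,0,1,0), (1,0,1,0),
      (1,0,0,1), (0,1,0,1), (0,1,0,0), (1,0,1,1), (1,0,0,0), (0,1,1,1)]),
    ([(0,1,0,1), (1,1,0,1)], [(0,0,0,1), (1,1,1,0), (0,0,0,1), (1,1,0,1), (0,0,1,0), (1,0,1,0),
      (1,0,0,1), (0,1,0,1), (0,1,0,0), (1,0,1,1), (1,0,0,0), (0,1,1,1), (1,0,0,0), (1,0,1,1)]),
    ([(0,1,0,1), (1,1,0,1)], [(0,0,0,0), (1,1,2,1), (0,0,0,0), (1,1,0,1), (0,0,0,1), (1,1,1,0),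
      (0,0,0,1), (1,1,0,1), (0,0,1,0), (1,0,1,0), (1,0,0,1), (0,1,0,1), (0,1,0,0), (1,0,1,1),
      (1,0,1,0)]),
    ([(0,1,0,1), (1,1,0,1)], [(0,0,0,1), (1,1,1,0), (0,0,0,1), (1,1,0,1), (0,0,1,0), (1,0,1,0),
      (1,0,0,1), (0,1,0,1), (0,1,0,0), (1,0,1,1), (1,0,0,0), (0,1,1,1), (0,0,1,0), (2,0,0,1),
      (0,0,0,1), (0,2,1,0), (0,0,0,1), (2,0,0,1), (0,0,1,0), (0,1,1,0), (1,0,0,1), (1,0,0,1),
      (0,1,1,0)]),
    ([(0,1,0,1), (1,1,0,1)], [(0,0,0,0), (1,1,2,1), (0,0,0,0), (1,1,0,1), (0,0,0,1), (1,1,1,0),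
      (0,0,0,1), (1,1,0,1), (0,0,1,0), (1,0,1,0), (1,0,0,1), (0,1,0,1), (0,1,0,0), (1,0,1,1),
      (1,0,0,0), (0,1,1,1), (0,1,0,0), (1,0,0,1), (1,0,1,1), (0,0,1,0), (1,1,0,0), (0,0,0,2),
      (1,1,0,0), (0,0,1,0), (1,0,1,1), (1,0,1,0)])]"

definition core :: "column list" where
  "core = [(0,1,1,0), (1,0,0,1), (1,0,0,1), (0,1,1,0)]"

definition link :: "column list" where
  "link = [(0,0,1,0), (2,0,0,1), (0,0,0,1), (0,2,1,0), (0,0,0,1), (2,0,0,1), (0,0,1,0)]"

text \<open>Appending \<open>link @ core\<close> costs 21 for 11 columns: initially this gains a unit earlier than
  \<open>cycle\<close> does, whence the exceptional lengths 4, 15, 26, 37, 48.\<close>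

definition sporadic :: "column list list" where
  "sporadic = map (\<lambda>k. core @ concat (replicate k (link @ core))) [0..<5] @ [
    [(0,1,0,1), (1,1,0,1)],
    [(0,0,1,0), (2,1,1,1), (0,0,1,0)],
    [(0,1,0,1), (1,1,0,1), (0,1,0,0), (0,0,1,1), (2,0,0,1)],
    [(1,0,1,1), (1,0,0,0), (0,1,1,1), (0,0,0,0), (2,1,1,1), (0,0,1,0)],
    [(0,2,0,0), (0,0,0,2), (2,0,0,0), (0,0,2,0), (2,0,0,0), (0,0,0,2), (0,2,0,0)],
    [(0,1,1,0), (1,0,0,1), (1,0,0,1), (0,1,1,0), (0,0,1,0), (2,0,0,1), (0,0,0,2), (0,2,0,0)],
    [(0,1,1,0), (1,0,0,1), (1,0,0,1), (0,1,1,0), (0,0,1,0), (2,0,0,1), (0,0,0,1), (0,2,1,0),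
      (0,0,0,1), (2,0,0,1), (0,0,1,0), (0,1,1,0), (1,0,0,1), (1,0,0,1), (0,1,1,0), (1,0,0,1),
      (1,0,0,1), (0,1,1,0)]]"

section \<open>Words attaining the bound at every length\<close>

text \<open>Equality in the bound of \<open>grid4_lower\<close>.\<close>

definition optimal :: "column list \<Rightarrow> bool" where
  "optimal w \<longleftrightarrow> accepts start w \<and>
    int (sum_list (map weight w)) = 2 * int (length w) - pot target (int (length w))"

lemma sporadic_optimal: "list_all optimal sporadic"
  by code_simp

lemma sporadic_lengths: "map length sporadic = [4, 15, 26, 37, 48, 2, 3, 5, 6, 7, 8, 18]"
  by code_simp

lemma run_cycle: "run hub cycle = Some hub" "length cycle = 10" "sum_list (map weight cycle) = 19"
  by code_simp+

lemma skeletons_correct: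
  "list_all (\<lambda>(u, v). run start u = Some hub \<and> accepts hub v \<and>
    int (sum_list (map weight (u @ v))) =
      2 * int (length (u @ v)) - (int (length (u @ v)) - 9) div 10) skeletons"
  by code_simp

text \<open>One length for each residue modulo 10. Residues 5 and 8 begin at 25 and 28 because 15
  and 18 are exceptional.\<close>

lemma skeleton_lengths:
  "map (\<lambda>(u, v). length (u @ v)) skeletons = [9, 10, 11, 12, 13, 14, 16, 17, 25, 28]"
  by code_simp

text \<open>Ten more columns at weight 19 raise the gain by one, just as they raise
  \<open>(n - 9) div 10\<close>. At exceptional lengths such as 26 the pumped word is one unit too
  heavy.\<close>

lemma pumped_word:
  assumes "(u, v) \<in> set skeletons"
  defines "w \<equiv> \<lambda>k. u @ concat (replicate k cycle) @ v"
  shows "accepts start (w k)" and "length (w k) = length (u @ v) + 10 * k"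
    and "int (sum_list (map weight (w k))) = 2 * int (length (w k)) - (int (length (w k)) - 9) div 10"
proof -
  have uv: "run start u = Some hub" "accepts hub v"
    "int (sum_list (map weight (u @ v))) =
      2 * int (length (u @ v)) - (int (length (u @ v)) - 9) div 10"
    using skeletons_correct assms(1) by (auto simp: list_all_iff)
  show "accepts start (w k)"
    using uv run_pump[OF run_cycle(1)] by (simp add: w_def accepts_def run_append)
  show len: "length (w k) = length (u @ v) + 10 * k"
    by (induction k) (auto simp: w_def run_cycle)
  have "sum_list (map weight (w k)) = sum_list (map weight (u @ v)) + 19 * k"
    by (induction k) (auto simp: w_def run_cycle)
  then show "int (sum_list (map weight (w k))) =
      2 * int (length (w k)) - (int (length (w k)) - 9) div 10"
    using uv(3) unfolding len by simp
qed

lemma optimal_word_exists: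
  assumes "2 \<le> n"
  shows "\<exists>w. length w = n \<and> optimal w"
proof (cases "n \<in> {2, 3, 4, 5, 6, 7, 8, 15, 18, 26, 37, 48}")
  \<comment> \<open>\<open>sporadic\<close> supplies the exceptional lengths and also 2, 3, 5, 6,
    which are shorter than every skeleton.\<close>
  case True
  then have "n \<in> set (map length sporadic)"
    unfolding sporadic_lengths by auto
  then show ?thesis
    using sporadic_optimal by (auto simp: list_all_iff)
next
  case False
  let ?L = "{9, 10, 11, 12, 13, 14, 16, 17, 25, 28 :: nat}"
  define q r where "q = n div 10" and "r = n mod 10"
  have n: "n = 10 * q + r" and "r \<in> {..<10}"
    by (simp_all add: q_def r_def)
  then have r: "r \<in> {0, 1, 2, 3, 4, 5, 6, 7, 8, 9}"
    by (simp add: lessThan_nat_numeral lessThan_Suc) blast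
  have "\<exists>l \<in> ?L. \<exists>k. n = l + 10 * k"
  proof -
    \<comment> \<open>Below 10 only 9 remains, and from 10 to 19 only 19 needs a cycle. From 20 on
      every residue has a skeleton that is short enough.\<close>
    consider "q = 0" | "q = 1" | p where "q = p + 2"
      by (metis One_nat_def add_2_eq_Suc' not0_implies_Suc)
    then show ?thesis
    proof cases
      case 1
      then have "n = 9 + 10 * 0" using n r False assms by auto
      then show ?thesis by blast
    next
      case 2
      then have "n = 9 + 10 * 1 \<or> (n \<in> ?L \<and> n = n + 10 * 0)" using n r False by auto
      then show ?thesis by blast
    next
      case (3 p)
      then have "n = 25 + 10 * p \<or> n = 28 + 10 * p \<or> n = 9 + 10 * q \<or>
          (10 + r \<in> ?L \<and> n = (10 + r) + 10 * (p + 1))"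
        using n r by auto
      then show ?thesis by blast
    qed
  qed
  then obtain l k where l: "l \<in> ?L" and k: "n = l + 10 * k" by blast
  from l have "l \<in> set (map (\<lambda>(u, v). length (u @ v)) skeletons)"
    unfolding skeleton_lengths by auto
  then obtain u v where uv: "(u, v) \<in> set skeletons" "length (u @ v) = l"
    by auto
  have "n \<notin> {4, 7, 8, 15, 18, 26, 37, 48}" "n \<noteq> 0"
    using False assms by auto
  then have "pot target (int n) = (int n - 9) div 10"
    by (simp only: pot_target of_bool_eq add_0_right simp_thms)
  then show ?thesis
    using pumped_word[OF uv(1), of k] uv(2) k unfolding optimal_def by metis
qed

section \<open>The domination numbers\<close>

lemma domination_number_grid4:
  assumes "2 \<le> n"
  shows "int (two_domination_number (grid_verts 4 n) (grid_adj 4 n)) = 2 * int n - pot target (int n)"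
proof (rule antisym)
  obtain w where "length w = n" "optimal w"
    using optimal_word_exists[OF assms] by blast
  then show "int (two_domination_number (grid_verts 4 n) (grid_adj 4 n)) \<le> 2 * int n - pot target (int n)"
    using grid4_upper[of w] by (simp add: optimal_def)
next
  obtain f where "two_dominating (grid_verts 4 n) (grid_adj 4 n) f"
    "two_domination_number (grid_verts 4 n) (grid_adj 4 n) = (\<Sum>x \<in> grid_verts 4 n. f x)"
    using two_domination_number_attained[of "grid_verts 4 n"] by (auto simp: grid_verts_def)
  then show "2 * int n - pot target (int n) \<le> int (two_domination_number (grid_verts 4 n) (grid_adj 4 n))"
    using grid4_lower by simp
qed

text \<open>Treated separately, since the general formula would give 3 for a single column.\<close>

lemma domination_number_path4: "two_domination_number (grid_verts 4 1) (grid_adj 4 1) = 4"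
proof (rule antisym)
  have "accepts start [(0, 2, 2, 0)]" by code_simp
  from grid4_upper[OF this] show "two_domination_number (grid_verts 4 1) (grid_adj 4 1) \<le> 4"
    by simp
next
  obtain f where f: "two_dominating (grid_verts 4 1) (grid_adj 4 1) f"
    "two_domination_number (grid_verts 4 1) (grid_adj 4 1) = (\<Sum>x \<in> grid_verts 4 1. f x)"
    using two_domination_number_attained[of "grid_verts 4 1"] by (auto simp: grid_verts_def)
  \<comment> \<open>The closed neighbourhoods of the two end vertices are disjoint and cover the
    path, and each carries weight at least 2.\<close>
  show "4 \<le> two_domination_number (grid_verts 4 1) (grid_adj 4 1)"
    using f(1) unfolding f(2) sum_grid4 two_dominating_grid4_iff by (simp add: column_of_def)
qed

theorem theorem3p6:
  fixes n :: nat and \<gamma> :: int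
  assumes "1 \<le> n" and "n \<le> 100"
  defines "\<gamma> \<equiv> int (two_domination_number (grid_verts 4 n) (grid_adj 4 n))"
  shows "(n = 1 \<longrightarrow> \<gamma> = 2 * int n + 2) \<and>
    (n \<in> {2, 3, 5, 6} \<longrightarrow> \<gamma> = 2 * int n + 1) \<and>
    (n \<in> {4} \<union> {7..14} \<union> {16, 17} \<longrightarrow> \<gamma> = 2 * int n) \<and>
    (n \<in> {15} \<union> {18..25} \<union> {27, 28} \<longrightarrow> \<gamma> = 2 * int n - 1) \<and>
    (n \<in> {26} \<union> {29..36} \<union> {38} \<longrightarrow> \<gamma> = 2 * int n - 2) \<and>
    (n \<in> {37} \<union> {39..47} \<longrightarrow> \<gamma> = 2 * int n - 3) \<and>
    (n \<in> {48..58} \<longrightarrow> \<gamma> = 2 * int n - 4) \<and>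
    (n \<in> {59..68} \<longrightarrow> \<gamma> = 2 * int n - 5) \<and>
    (n \<in> {69..78} \<longrightarrow> \<gamma> = 2 * int n - 6) \<and>
    (n \<in> {79..88} \<longrightarrow> \<gamma> = 2 * int n - 7) \<and>
    (n \<in> {89..98} \<longrightarrow> \<gamma> = 2 * int n - 8) \<and>
    (n \<in> {99, 100} \<longrightarrow> \<gamma> = 2 * int n - 9)"
proof (cases "n = 1")
  case True
  then show ?thesis
    using domination_number_path4 by (simp add: \<gamma>_def)
next
  case False
  then have "\<gamma> = 2 * int n - pot target (int n)"
    unfolding \<gamma>_def using assms by (intro domination_number_grid4) simp
  then have \<gamma>: "\<gamma> = 2 * int n - (int n - 9) div 10 - of_bool (n \<in> {4, 7, 8, 15, 18, 26, 37, 48})"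
    using pot_target[of n] assms(1) by linarith
  show ?thesis
  proof (cases "n \<in> {4, 7, 8, 15, 18, 26, 37, 48}")
    case True
    then have "n = 4 \<or> n = 7 \<or> n = 8 \<or> n = 15 \<or> n = 18 \<or> n = 26 \<or> n = 37 \<or> n = 48"
      by simp
    then show ?thesis
      unfolding \<gamma> by (elim disjE) simp_all
  next
    case exc: False
    then have neq: "n \<noteq> 4" "n \<noteq> 7" "n \<noteq> 8" "n \<noteq> 15" "n \<noteq> 18" "n \<noteq> 26" "n \<noteq> 37" "n \<noteq> 48"
      by blast+
    have "\<gamma> = 2 * int n - (int n - 9) div 10"
      unfolding \<gamma> using exc by (simp only: of_bool_eq diff_zero simp_thms)
    \<comment> \<open>The quotient is \<open>d\<close> on a block of ten lengths. The exceptional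
      lengths gain one unit more than their block, so the theorem lists them with the next value of
      \<open>d\<close>; there \<open>neq\<close> rules them out.\<close>
    then have val: "\<gamma> = 2 * int n - d" if "9 + 10 * d \<le> int n" "int n < 19 + 10 * d" for d
      using that by linarith
    show ?thesis
    proof (intro conjI impI)
      show "\<gamma> = 2 * int n + 2" if "n = 1"
        using that False by blast
      show "\<gamma> = 2 * int n + 1" if "n \<in> {2, 3, 5, 6}"
        by (rule val[of "- 1", simplified]) (use that in auto)
      show "\<gamma> = 2 * int n" if "n \<in> {4} \<union> {7..14} \<union> {16, 17}"
        by (rule val[of 0, simplified]) (use that neq(1-3) in auto)
      show "\<gamma> = 2 * int n - 1" if "n \<in> {15} \<union> {18..25} \<union> {27, 28}"
        by (rule val[of 1, simplified]) (use that neq(4,5) in auto)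
      show "\<gamma> = 2 * int n - 2" if "n \<in> {26} \<union> {29..36} \<union> {38}"
        by (rule val[of 2, simplified]) (use that neq(6) in auto)
      show "\<gamma> = 2 * int n - 3" if "n \<in> {37} \<union> {39..47}"
        by (rule val[of 3, simplified]) (use that neq(7) in auto)
      show "\<gamma> = 2 * int n - 4" if "n \<in> {48..58}"
        by (rule val[of 4, simplified]) (use that neq(8) in auto)
      show "\<gamma> = 2 * int n - 5" if "n \<in> {59..68}"
        by (rule val[of 5, simplified]) (use that in auto)
      show "\<gamma> = 2 * int n - 6" if "n \<in> {69..78}"
        by (rule val[of 6, simplified]) (use that in auto)
      show "\<gamma> = 2 * int n - 7" if "n \<in> {79..88}"
        by (rule val[of 7, simplified]) (use that in auto)
      show "\<gamma> = 2 * int n - 8" if "n \<in> {89..98}"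
        by (rule val[of 8, simplified]) (use that in auto)
      show "\<gamma> = 2 * int n - 9" if "n \<in> {99, 100}"
        by (rule val[of 9, simplified]) (use that in auto)
    qed
  qed
qed

end
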